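(* Let $0<p<\infty$, and let $\psi$ and $\varphi$ be analytic functions on the open unit disk $\mathbb{D}$ with $\varphi(\mathbb{D})\subseteq\mathbb{D}$. The composition operator $C_\varphi$, $C_\varphi f=f\circ\varphi$, is invertible on $S^p$ if and only if $\varphi$ is an automorphism of $\mathbb{D}$. Moreover, the weighted composition operator $W_{\psi,\varphi}$, $W_{\psi,\varphi}f=\psi\cdot(f\circ\varphi)$, is invertible on $S^p$ if and only if $\varphi$ is an automorphism of $\mathbb{D}$ and both $\psi$ and $1/\psi$ are multipliers of $S^p$.
   Context: $\mathbb{D}=\{z\in\mathbb{C}:|z|<1\}$. For $0<p<\infty$, the Hardy space $H^p(\mathbb{D})$ consists of all analytic $f$ on $\mathbb{D}$ with $\sup_{0\le r<1}\frac{1}{2\pi}\int_0^{2\pi}|f(re^{it})|^p\,dt<\infty$, and $S^p$ is the set of all analytic $f$ on $\mathbb{D}$ such that $f'\in H^p(\mathbb{D})$. An operator being "invertible on $S^p$" means that it maps $S^p$ into itself and is a bijection of $S^p$ onto $S^p$. An automorphism of $\mathbb{D}$ is an analytic bijection of $\mathbb{D}$ onto $\mathbb{D}$. A function $g$ on $\mathbb{D}$ is a multiplier of $S^p$ if $gf\in S^p$ whenever $f\in S^p$; saying that $1/\psi$ is a multiplier includes that $\psi$ has no zeros in $\mathbb{D}$, so that $1/\psi$ is a function on $\mathbb{D}$. *)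

theory Defs
  imports "HOL-Complex_Analysis.Complex_Analysis" "HOL-Library.FuncSet"
begin

abbreviation unit_disk :: "complex set" (\<open>\<bbbD>\<close>) where
  "\<bbbD> \<equiv> ball 0 1"

text \<open>
  Functions on the disk are represented by total functions that are
  \<^const>\<open>undefined\<close> outside the disk (\<^const>\<open>extensional\<close>), so that equality in the
  function spaces below is equality of functions on the disk. This is what makes
  injectivity and surjectivity of operators meaningful.
\<close>

definition hardy_space :: "real \<Rightarrow> (complex \<Rightarrow> complex) set" where
  "hardy_space p = {f \<in> extensional \<bbbD>. f holomorphic_on \<bbbD> \<and>
     bdd_above ((\<lambda>r. 1 / (2 * pi) *
       integral {0..2 * pi} (\<lambda>t. norm (f (of_real r * cis t)) powr p)) ` {0..<1})}"

definition S_space :: "real \<Rightarrow> (complex \<Rightarrow> complex) set" where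
  "S_space p = {f \<in> extensional \<bbbD>. f holomorphic_on \<bbbD> \<and>
     restrict (deriv f) \<bbbD> \<in> hardy_space p}"

definition comp_op :: "(complex \<Rightarrow> complex) \<Rightarrow> (complex \<Rightarrow> complex) \<Rightarrow> complex \<Rightarrow> complex" where
  "comp_op \<phi> f = (\<lambda>z\<in>\<bbbD>. f (\<phi> z))"

definition weighted_comp_op ::
  "(complex \<Rightarrow> complex) \<Rightarrow> (complex \<Rightarrow> complex) \<Rightarrow> (complex \<Rightarrow> complex) \<Rightarrow> complex \<Rightarrow> complex" where
  "weighted_comp_op \<psi> \<phi> f = (\<lambda>z\<in>\<bbbD>. \<psi> z * f (\<phi> z))"

definition invertible_on_S :: "real \<Rightarrow> ((complex \<Rightarrow> complex) \<Rightarrow> complex \<Rightarrow> complex) \<Rightarrow> bool" where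
  "invertible_on_S p T \<longleftrightarrow> T \<in> S_space p \<rightarrow> S_space p \<and> bij_betw T (S_space p) (S_space p)"

definition disk_automorphism :: "(complex \<Rightarrow> complex) \<Rightarrow> bool" where
  "disk_automorphism \<phi> \<longleftrightarrow> \<phi> holomorphic_on \<bbbD> \<and> bij_betw \<phi> \<bbbD> \<bbbD>"

definition S_multiplier :: "real \<Rightarrow> (complex \<Rightarrow> complex) \<Rightarrow> bool" where
  "S_multiplier p g \<longleftrightarrow> (\<forall>f \<in> S_space p. (\<lambda>z\<in>\<bbbD>. g z * f z) \<in> S_space p)"

text \<open>
  Since \<open>1 / 0 = 0\<close> in HOL, that the reciprocal of \<open>\<psi>\<close> is a function on the disk has
  to be stated separately.
\<close>

definition reciprocal_S_multiplier :: "real \<Rightarrow> (complex \<Rightarrow> complex) \<Rightarrow> bool" where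
  "reciprocal_S_multiplier p \<psi> \<longleftrightarrow>
     (\<forall>z\<in>\<bbbD>. \<psi> z \<noteq> 0) \<and> S_multiplier p (\<lambda>z. 1 / \<psi> z)"

end

theory Submission
  imports Defs "HOL-Computational_Algebra.Fundamental_Theorem_Algebra"
begin

text \<open>
An automorphism \<open>\<phi>\<close> of the disk is a rotation of a Moebius map, so \<open>\<phi>'\<close> is bounded. As
\<open>(f \<circ> \<phi>)' = \<phi>' * (f' \<circ> \<phi>)\<close>, composition with \<open>\<phi>\<close> preserves the space as soon as it preserves the Hardy
space; the inverse automorphism gives the inverse operator. That composition with a
self-map of the disk preserves the Hardy space is Littlewood's subordination
theorem (\<open>hardy_space_comp\<close>). It rests on the inequality that \<open>\<bar>g\<bar> powr p\<close> is at most its own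
Poisson integral, for every \<open>p > 0\<close>. For polynomials this follows by
reflecting the zeros in the circle, which leaves a function with holomorphic \<open>p\<close>-th power
(\<open>poly_powr_majorant\<close>); the general case follows by uniform approximation.

Conversely, let the weighted operator be onto. Preimages of \<open>1\<close> and of the identity have a
quotient that is a left inverse of \<open>\<phi>\<close>, so \<open>\<phi>\<close> is injective. If \<open>\<phi>\<close> were not onto, this quotient
would be a meromorphic function on the disk that takes a unimodular value \<open>w\<close> at
some boundary point \<open>b\<close> of the image of \<open>\<phi>\<close>. But the functions \<open>1 - cnj w * z\<close> raised to
\<open>1 + 1 / K\<close> lie in the space, and their preimages show that \<open>1\<close> minus \<open>cnj w\<close> times the quotient has
a meromorphic \<open>K\<close>-th root at its zero \<open>b\<close>, for all \<open>K\<close>, which is absurd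
(\<open>disk_automorphism_of_surj_weighted_comp_op\<close>). Hence \<open>\<phi>\<close> is an automorphism, the composition
operator is invertible, and the weighted operator is invertible exactly when multiplication
by \<open>\<psi>\<close> is, which amounts to \<open>\<psi>\<close> and \<open>1 / \<psi>\<close> being multipliers.
\<close>

section \<open>Means over the unit circle\<close>

definition circle_mean :: "(complex \<Rightarrow> real) \<Rightarrow> real" where
  "circle_mean u = 1 / (2 * pi) * integral {0..2 * pi} (\<lambda>t. u (cis t))"

lemma continuous_on_cis_circle:
  fixes u :: "complex \<Rightarrow> 'a::topological_space"
  assumes "continuous_on (sphere 0 1) u"
  shows "continuous_on A (\<lambda>t. u (cis t))"
  by (rule continuous_on_compose2[OF assms]) (auto intro!: continuous_intros)

lemma integrable_on_circle:
  fixes u :: "complex \<Rightarrow> real"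
  assumes "continuous_on (sphere 0 1) u"
  shows "(\<lambda>t. u (cis t)) integrable_on {0..2 * pi}"
  by (intro integrable_continuous_real continuous_on_cis_circle assms)

lemma circle_mean_mono:
  assumes "continuous_on (sphere 0 1) u" "continuous_on (sphere 0 1) v"
    and "\<And>w. norm w = 1 \<Longrightarrow> u w \<le> v w"
  shows "circle_mean u \<le> circle_mean v"
  unfolding circle_mean_def
  by (intro mult_left_mono integral_le integrable_on_circle assms(1,2)) (auto intro: assms(3))

lemma circle_mean_cmult: "circle_mean (\<lambda>w. c * u w) = c * circle_mean u"
  unfolding circle_mean_def by simp

lemma circle_mean_swap:
  assumes "continuous_on (sphere 0 1 \<times> sphere 0 1) (\<lambda>(v, w). u v w)"
  shows "circle_mean (\<lambda>v. circle_mean (u v)) = circle_mean (\<lambda>w. circle_mean (\<lambda>v. u v w))"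
proof -
  have "continuous_on A (\<lambda>x. (\<lambda>(v, w). u v w) (cis (fst x), cis (snd x)))" for A
    by (rule continuous_on_compose2[OF assms]) (auto intro!: continuous_intros)
  hence "continuous_on (cbox (0, 0) (2 * pi, 2 * pi)) (\<lambda>(s, t). u (cis s) (cis t))"
    by (simp add: case_prod_unfold)
  from integral_swap_continuous[OF this] show ?thesis
    unfolding circle_mean_def by simp
qed

lemma continuous_on_circle_mean_param:
  fixes u :: "'a::topological_space \<Rightarrow> complex \<Rightarrow> real"
  assumes "continuous_on (A \<times> sphere 0 1) (\<lambda>(x, w). u x w)"
  shows "continuous_on A (\<lambda>x. circle_mean (u x))"
proof -
  have "continuous_on (A \<times> cbox 0 (2 * pi)) (\<lambda>x. (\<lambda>(x, w). u x w) (fst x, cis (snd x)))"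
    by (rule continuous_on_compose2[OF assms]) (auto intro!: continuous_intros)
  hence "continuous_on (A \<times> cbox 0 (2 * pi)) (\<lambda>(x, t). u x (cis t))"
    by (simp add: case_prod_unfold)
  from integral_continuous_on_param[OF this] show ?thesis
    unfolding circle_mean_def by (intro continuous_intros) simp
qed

lemma tendsto_circle_mean:
  assumes lim: "uniform_limit (sphere 0 1) u v F"
    and cont: "\<And>n. continuous_on (sphere 0 1) (u n)" and "F \<noteq> bot"
  shows "((\<lambda>n. circle_mean (u n)) \<longlongrightarrow> circle_mean v) F"
proof -
  have "uniform_limit {0..2 * pi} (\<lambda>n t. u n (cis t)) (\<lambda>t. v (cis t)) F"
    by (rule uniform_limit_compose'[OF lim]) auto
  then obtain I J where *: "\<And>n. ((\<lambda>t. u n (cis t)) has_integral I n) {0..2 * pi}"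
      "((\<lambda>t. v (cis t)) has_integral J) {0..2 * pi}" "(I \<longlongrightarrow> J) F"
    using continuous_on_cis_circle[OF cont] \<open>F \<noteq> bot\<close>
    by (elim uniform_limit_integral) auto
  have "integral {0..2 * pi} (\<lambda>t. u n (cis t)) = I n" for n
    using *(1) by blast
  moreover have "integral {0..2 * pi} (\<lambda>t. v (cis t)) = J"
    using *(2) by blast
  ultimately show ?thesis
    unfolding circle_mean_def using *(3) by (intro tendsto_intros) simp
qed

section \<open>The Poisson formula\<close>

definition poisson_kernel :: "complex \<Rightarrow> complex \<Rightarrow> real" where
  "poisson_kernel z w = (1 - (norm z)\<^sup>2) / (norm (w - z))\<^sup>2"

lemma poisson_kernel_nonneg: "norm z < 1 \<Longrightarrow> 0 \<le> poisson_kernel z w"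
  by (simp add: poisson_kernel_def power_le_one)

lemma poisson_kernel_bound:
  assumes "norm z < 1" "norm w = 1"
  shows "poisson_kernel z w \<le> (1 + norm z) / (1 - norm z)"
proof -
  have "1 - norm z \<le> norm (w - z)"
    using norm_triangle_ineq2[of w z] assms by simp
  hence "poisson_kernel z w \<le> (1 - (norm z)\<^sup>2) / (1 - norm z)\<^sup>2"
    unfolding poisson_kernel_def using assms
    by (intro divide_left_mono power_mono mult_pos_pos) (auto simp: power_le_one)
  also have "\<dots> = (1 + norm z) / (1 - norm z)"
    using assms by (simp add: power2_eq_square square_diff_one_factored[symmetric] divide_simps)
      (simp add: algebra_simps)
  finally show ?thesis .
qed

lemma poisson_kernel_eq_Re:
  assumes "norm w = 1"
  shows "poisson_kernel z w = Re ((w + z) / (w - z))"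
proof -
  have "Re ((w + z) / (w - z)) = Re ((w + z) * cnj (w - z)) / (norm (w - z))\<^sup>2"
    by (simp only: complex_div_cnj[of "w + z"] Re_divide_of_real)
  also have "Re ((w + z) * cnj (w - z)) = (norm w)\<^sup>2 - (norm z)\<^sup>2"
    unfolding cmod_power2 by (simp add: algebra_simps power2_eq_square)
  finally show ?thesis
    using assms by (simp add: poisson_kernel_def)
qed

lemma continuous_on_poisson_kernel:
  "continuous_on (ball 0 1 \<times> sphere 0 1) (\<lambda>(z, w). poisson_kernel z w)"
  unfolding poisson_kernel_def case_prod_unfold
  by (auto intro!: continuous_intros)

lemma continuous_on_poisson_kernel_circle:
  assumes "norm z < 1"
  shows "continuous_on (sphere 0 1) (poisson_kernel z)"
  unfolding poisson_kernel_def using assms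
  by (auto intro!: continuous_intros)

text \<open>
For fixed \<open>z\<close> the factor \<open>(1 - \<bar>z\<bar>\<^sup>2) / (1 - cnj z * w)\<close> is holomorphic in \<open>w\<close> and equals \<open>1\<close>
at \<open>w = z\<close>, and on the unit circle it turns the Cauchy kernel \<open>w / (w - z)\<close> into the
Poisson kernel. So this is Cauchy's formula for \<open>F\<close> times that factor.
\<close>
lemma poisson_formula:
  assumes cont: "continuous_on (cball 0 1) F" and holo: "F holomorphic_on ball 0 1"
    and z: "norm z < 1"
  shows "((\<lambda>t. of_real (poisson_kernel z (cis t)) * F (cis t)) has_integral 2 * of_real pi * F z)
    {0..2 * pi}"
proof -
  define G where "G = (\<lambda>w. F w * (1 - z * cnj z) / (1 - cnj z * w))"
  have nz: "1 - cnj z * w \<noteq> 0" if "norm w \<le> 1" for w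
  proof
    assume "1 - cnj z * w = 0"
    hence "norm (cnj z * w) = 1" by simp
    moreover have "norm z * norm w \<le> norm z * 1"
      using that by (intro mult_left_mono) auto
    ultimately show False using z by (simp add: norm_mult)
  qed
  have "((\<lambda>w. G w / (w - z)) has_contour_integral 2 * of_real pi * \<i> * G z) (circlepath 0 1)"
  proof (rule Cauchy_integral_circlepath)
    show "continuous_on (cball 0 1) G"
      unfolding G_def using nz by (auto intro!: continuous_intros cont)
    show "G holomorphic_on ball 0 1"
      unfolding G_def using nz by (auto intro!: holomorphic_intros holo)
  qed (use z in simp)
  hence "((\<lambda>t. G (cis t) / (cis t - z) * \<i> * cis t) has_integral 2 * of_real pi * \<i> * G z)
      {0..2 * pi}"
    unfolding circlepath_def by (subst (asm) has_contour_integral_part_circlepath_iff) auto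
  hence "((\<lambda>t. G (cis t) / (cis t - z) * \<i> * cis t * - \<i>) has_integral
      2 * of_real pi * \<i> * G z * - \<i>) {0..2 * pi}"
    by (rule has_integral_mult_left)
  moreover have "2 * of_real pi * \<i> * G z * - \<i> = 2 * of_real pi * F z"
  proof -
    have "G z = F z" using nz[of z] z by (simp add: G_def mult.commute)
    moreover have "2 * of_real pi * \<i> * G z * - \<i> = 2 * of_real pi * G z * (\<i> * - \<i>)"
      by (simp only: ac_simps)
    ultimately show ?thesis by simp
  qed
  moreover have "G (cis t) / (cis t - z) * \<i> * cis t * - \<i> =
      of_real (poisson_kernel z (cis t)) * F (cis t)" for t
  proof -
    define w where "w = cis t"
    have w: "w * cnj w = 1" "norm w = 1"
      by (simp_all add: w_def cis_mult cis_cnj)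
    hence "w \<noteq> 0" "w \<noteq> z" using z by auto
    have "1 - cnj z * w = w * cnj (w - z)"
      using w(1) by (simp add: algebra_simps)
    hence "G w / (w - z) * w = F w * (1 - z * cnj z) / (w - z) / cnj (w - z)"
      using \<open>w \<noteq> 0\<close> by (simp add: G_def)
    moreover have "G w / (w - z) * \<i> * w * - \<i> = G w / (w - z) * w * (\<i> * - \<i>)"
      by (simp only: ac_simps)
    ultimately have "G w / (w - z) * \<i> * w * - \<i> = F w * (1 - z * cnj z) / (w - z) / cnj (w - z)"
      by simp
    also have "\<dots> = (1 - z * cnj z) / ((w - z) * cnj (w - z)) * F w"
      by simp
    also have "(1 - z * cnj z) / ((w - z) * cnj (w - z)) = of_real (poisson_kernel z w)"
      unfolding poisson_kernel_def complex_norm_square[symmetric] by simp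
    finally show ?thesis by (simp add: w_def)
  qed
  ultimately show ?thesis by (simp only:)
qed

lemma norm_le_poisson_mean:
  assumes cont: "continuous_on (cball 0 1) F" and holo: "F holomorphic_on ball 0 1"
    and z: "norm z < 1"
  shows "norm (F z) \<le> circle_mean (\<lambda>w. poisson_kernel z w * norm (F w))"
proof -
  note P = poisson_formula[OF assms]
  have "norm (2 * of_real pi * F z) \<le> integral {0..2 * pi} (\<lambda>t. poisson_kernel z (cis t) * norm (F (cis t)))"
    unfolding integral_unique[OF P, symmetric]
  proof (rule integral_norm_bound_integral)
    show "(\<lambda>t. poisson_kernel z (cis t) * norm (F (cis t))) integrable_on {0..2 * pi}"
      by (rule integrable_on_circle)
        (auto intro!: continuous_intros continuous_on_poisson_kernel_circle z continuous_on_subset[OF cont])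
  qed (use P z in \<open>auto simp: norm_mult poisson_kernel_nonneg\<close>)
  thus ?thesis
    by (simp add: circle_mean_def norm_mult field_simps)
qed

lemma circle_mean_Re_holomorphic:
  assumes "continuous_on (cball 0 1) F" "F holomorphic_on ball 0 1"
  shows "circle_mean (\<lambda>w. Re (F w)) = Re (F 0)"
proof -
  have "((\<lambda>t. F (cis t)) has_integral 2 * of_real pi * F 0) {0..2 * pi}"
    using poisson_formula[OF assms, of 0] by (simp add: poisson_kernel_def)
  from has_integral_Re[OF this] have "integral {0..2 * pi} (\<lambda>t. Re (F (cis t))) = 2 * pi * Re (F 0)"
    by (auto dest: integral_unique)
  thus ?thesis by (simp add: circle_mean_def)
qed

section \<open>Powers of the modulus are subharmonic\<close>

text \<open>
A zero \<open>a\<close> inside the disk is reflected to \<open>1 / cnj a\<close>, as division by a Blaschke factor would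
do; a zero elsewhere stays where it is. In both cases the new factor has positive real part
inside the disk, so that its real powers have a principal branch there.
\<close>
lemma linear_factor_majorant:
  fixes a :: complex
  obtains b :: complex and c :: real where "0 < c" "norm b \<le> 1"
    "\<And>w. norm w = 1 \<Longrightarrow> norm (w - a) = c * norm (1 - b * w)"
    "\<And>z. norm z < 1 \<Longrightarrow> norm (z - a) \<le> c * norm (1 - b * z)"
proof (cases "norm a < 1")
  case True
  have id: "(norm (1 - cnj a * z))\<^sup>2 - (norm (z - a))\<^sup>2 = (1 - (norm a)\<^sup>2) * (1 - (norm z)\<^sup>2)" for z
    unfolding cmod_power2 by (simp add: algebra_simps power2_eq_square)
  show ?thesis
  proof (rule that[of 1 "cnj a"])
    fix z :: complex assume "norm z = 1"
    with id[of z] show "norm (z - a) = 1 * norm (1 - cnj a * z)"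
      by simp
  next
    fix z :: complex assume "norm z < 1"
    hence "0 \<le> (1 - (norm a)\<^sup>2) * (1 - (norm z)\<^sup>2)"
      using True by (intro mult_nonneg_nonneg) (auto simp: power_le_one)
    with id[of z] have "(norm (z - a))\<^sup>2 \<le> (norm (1 - cnj a * z))\<^sup>2"
      by linarith
    thus "norm (z - a) \<le> 1 * norm (1 - cnj a * z)"
      by (simp add: power2_le_iff_abs_le)
  qed (use True in auto)
next
  case False
  hence "a \<noteq> 0" by auto
  have "norm (z - a) = norm a * norm (1 - 1 / a * z)" for z
    using \<open>a \<noteq> 0\<close> by (simp add: norm_mult[symmetric] algebra_simps norm_minus_commute)
  thus ?thesis
    using False \<open>a \<noteq> 0\<close> by (intro that[of "norm a" "1 / a"]) (auto simp: norm_divide divide_simps)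
qed

lemma continuous_on_norm_powr [continuous_intros]:
  fixes f :: "'a::topological_space \<Rightarrow> complex"
  assumes "0 < p" "continuous_on A f"
  shows "continuous_on A (\<lambda>x. norm (f x) powr p)"
  using assms by (intro continuous_on_powr' continuous_intros) auto

lemma norm_powr_of_real: "norm (z powr of_real p) = norm z powr p" for z :: complex
  by (simp add: powr_def)

text \<open>
For \<open>w\<close> in the closed disk \<open>1 - b * w\<close> lies in the closed right half plane;
therefore its principal power extends continuously to the zero that it has on the circle when \<open>\<bar>b\<bar> = 1\<close>.
\<close>
lemma linear_factor_power:
  assumes "0 < p" "norm b \<le> 1"
  shows "continuous_on (cball 0 1) (\<lambda>w. (1 - b * w) powr of_real p)"
    and "(\<lambda>w. (1 - b * w) powr of_real p) holomorphic_on ball 0 1"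
proof -
  have *: "Re (b * w) \<le> norm w" for w
    by (metis assms(2) complex_Re_le_cmod mult_left_le_one_le norm_ge_zero norm_mult order_trans)
  have "0 \<le> Re (1 - b * w)" if "norm w \<le> 1" for w
    using *[of w] that by simp
  thus "continuous_on (cball 0 1) (\<lambda>w. (1 - b * w) powr of_real p)"
    using assms(1) by (intro continuous_on_powr_complex) (auto intro!: continuous_intros)
  have "1 - b * w \<notin> \<real>\<^sub>\<le>\<^sub>0" if "norm w < 1" for w
    using *[of w] that by (auto simp: complex_nonpos_Reals_iff)
  thus "(\<lambda>w. (1 - b * w) powr of_real p) holomorphic_on ball 0 1"
    by (auto intro!: holomorphic_intros)
qed

text \<open>
The power \<open>\<bar>q\<bar> powr p\<close> is in general not the modulus of a holomorphic function, because \<open>q\<close> may have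
zeros in the disk. Reflecting these zeros changes nothing on the circle and only increases
the modulus inside; then a branch of the power exists.
\<close>
lemma poly_powr_majorant:
  fixes q :: "complex poly"
  assumes p: "0 < p"
  shows "\<exists>F. continuous_on (cball 0 1) F \<and> F holomorphic_on ball 0 1 \<and>
    (\<forall>w. norm w = 1 \<longrightarrow> norm (F w) = norm (poly q w) powr p) \<and>
    (\<forall>z. norm z < 1 \<longrightarrow> norm (poly q z) powr p \<le> norm (F z))"
proof (induction "degree q" arbitrary: q)
  case 0
  then obtain c where "q = [:c:]" by (metis degree_eq_zeroE)
  thus ?case
    by (intro exI[of _ "\<lambda>_. of_real (norm c powr p)"]) auto
next
  case (Suc n)
  then obtain a where "poly q a = 0"
    using alg_closed_imp_poly_has_root[of q] by auto
  then obtain q' where q: "q = [:-a, 1:] * q'"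
    by (metis dvdE poly_eq_0_iff_dvd)
  have poly_q: "poly q w = (w - a) * poly q' w" for w
    by (simp add: q algebra_simps)
  have "degree q' = n"
    using Suc.hyps(2) q degree_mult_eq[of "[:-a, 1:]" q'] by (cases "q' = 0") auto
  with Suc.hyps(1) obtain F where F: "continuous_on (cball 0 1) F" "F holomorphic_on ball 0 1"
      "\<And>w. norm w = 1 \<Longrightarrow> norm (F w) = norm (poly q' w) powr p"
      "\<And>z. norm z < 1 \<Longrightarrow> norm (poly q' z) powr p \<le> norm (F z)"
    by metis
  obtain b c where bc: "0 < c" "norm b \<le> 1"
      "\<And>w. norm w = 1 \<Longrightarrow> norm (w - a) = c * norm (1 - b * w)"
      "\<And>z. norm z < 1 \<Longrightarrow> norm (z - a) \<le> c * norm (1 - b * z)"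
    using linear_factor_majorant[of a] by metis
  define G where "G = (\<lambda>w. of_real (c powr p) * (1 - b * w) powr of_real p * F w)"
  have G: "norm (G w) = (c * norm (1 - b * w)) powr p * norm (F w)" for w
    using \<open>0 < c\<close> by (simp add: G_def norm_mult norm_powr_of_real powr_mult)
  show ?case
  proof (intro exI[of _ G] conjI allI impI)
    show "continuous_on (cball 0 1) G" "G holomorphic_on ball 0 1"
      unfolding G_def
      by (intro continuous_intros holomorphic_intros linear_factor_power p bc F)+
  next
    fix w :: complex assume "norm w = 1"
    thus "norm (G w) = norm (poly q w) powr p"
      unfolding G bc(3)[OF \<open>norm w = 1\<close>, symmetric] F(3)[OF \<open>norm w = 1\<close>]
      by (simp add: poly_q norm_mult powr_mult)
  next
    fix z :: complex assume z: "norm z < 1"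
    have "norm (poly q z) powr p = norm (z - a) powr p * norm (poly q' z) powr p"
      by (simp add: poly_q norm_mult powr_mult)
    also have "\<dots> \<le> (c * norm (1 - b * z)) powr p * norm (F z)"
      using p bc(4)[OF z] F(4)[OF z] by (intro mult_mono powr_mono2) auto
    finally show "norm (poly q z) powr p \<le> norm (G z)" by (simp add: G)
  qed
qed

text \<open>
This is the subharmonicity of \<open>\<bar>q\<bar> powr p\<close>, valid down to exponents below \<open>1\<close> because the Poisson
formula is applied to the majorant with exponent \<open>1\<close>.
\<close>
lemma poly_powr_le_poisson_mean:
  fixes q :: "complex poly"
  assumes "0 < p" "norm z < 1"
  shows "norm (poly q z) powr p \<le> circle_mean (\<lambda>w. poisson_kernel z w * norm (poly q w) powr p)"
proof -
  obtain F where F: "continuous_on (cball 0 1) F" "F holomorphic_on ball 0 1"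
      "\<And>w. norm w = 1 \<Longrightarrow> norm (F w) = norm (poly q w) powr p"
      "norm (poly q z) powr p \<le> norm (F z)"
    using poly_powr_majorant[OF assms(1), of q] assms(2) by metis
  have "norm (F z) \<le> circle_mean (\<lambda>w. poisson_kernel z w * norm (F w))"
    by (intro norm_le_poisson_mean F assms)
  also have "\<dots> = circle_mean (\<lambda>w. poisson_kernel z w * norm (poly q w) powr p)"
    by (simp add: circle_mean_def F(3))
  finally show ?thesis using F(4) by linarith
qed

lemma uniform_limit_polys_dilation:
  assumes g: "g holomorphic_on ball 0 1" and \<rho>: "0 \<le> \<rho>" "\<rho> < 1"
  obtains q :: "nat \<Rightarrow> complex poly"
  where "uniform_limit (cball 0 1) (\<lambda>n. poly (q n)) (\<lambda>w. g (of_real \<rho> * w)) sequentially"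
proof -
  define a where "a = (\<lambda>n. (deriv ^^ n) g 0 / fact n)"
  have sums: "(\<lambda>n. a n * w ^ n) sums g w" if "norm w < 1" for w
    using holomorphic_power_series[OF g, of w] that by (simp add: a_def)
  have "1 \<le> conv_radius a"
  proof (rule conv_radius_geI_ex')
    fix r :: real assume "0 < r" "ereal r < 1"
    thus "summable (\<lambda>n. a n * of_real r ^ n)"
      using sums[of "of_real r"] by (auto simp: sums_iff)
  qed
  hence "ereal \<rho> < conv_radius a"
    using \<rho> by (metis ereal_less(3) less_le_trans)
  from powser_uniform_limit[OF this, of 0]
  have "uniform_limit (cball 0 \<rho>) (\<lambda>n x. \<Sum>i<n. a i * x ^ i) (\<lambda>x. \<Sum>i. a i * x ^ i) sequentially"
    by simp
  hence "uniform_limit (cball 0 1) (\<lambda>n w. \<Sum>i<n. a i * (of_real \<rho> * w) ^ i)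
      (\<lambda>w. \<Sum>i. a i * (of_real \<rho> * w) ^ i) sequentially"
    by (rule uniform_limit_compose')
      (use \<rho> in \<open>auto simp: norm_mult intro: mult_left_le\<close>)
  also have "?this \<longleftrightarrow> uniform_limit (cball 0 1)
      (\<lambda>n. poly (\<Sum>i<n. monom (a i * of_real \<rho> ^ i) i)) (\<lambda>w. g (of_real \<rho> * w)) sequentially"
  proof (intro uniform_limit_cong' refl)
    fix w :: complex assume "w \<in> cball 0 1"
    hence "norm (of_real \<rho> * w) < 1"
      using \<rho> mult_left_le[of "norm w" \<rho>] by (simp add: norm_mult)
    from sums[OF this] show "(\<Sum>i. a i * (of_real \<rho> * w) ^ i) = g (of_real \<rho> * w)"
      by (simp add: sums_iff)
  qed (simp add: poly_sum poly_monom power_mult_distrib mult.assoc)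
  finally show ?thesis by (rule that)
qed

lemma continuous_on_dilation:
  fixes g :: "complex \<Rightarrow> complex"
  assumes "g holomorphic_on ball 0 1" "0 \<le> \<rho>" "\<rho> < 1"
  shows "continuous_on (cball 0 1) (\<lambda>w. g (of_real \<rho> * w))"
proof (rule continuous_on_compose2[OF holomorphic_on_imp_continuous_on[OF assms(1)]])
  show "(\<lambda>w. of_real \<rho> * w) ` cball 0 1 \<subseteq> ball (0::complex) 1"
    using assms(2,3) mult_left_le[of _ \<rho>] by (force simp: norm_mult)
qed (auto intro!: continuous_intros)

text \<open>
Taylor polynomials converge uniformly to the dilation on the closed disk, so the inequality
for polynomials passes to the limit.
\<close>
lemma dilation_powr_le_poisson_mean:
  assumes "0 < p" and g: "g holomorphic_on ball 0 1" and \<rho>: "0 \<le> \<rho>" "\<rho> < 1"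
    and z: "norm z < 1"
  shows "norm (g (of_real \<rho> * z)) powr p \<le>
    circle_mean (\<lambda>w. poisson_kernel z w * norm (g (of_real \<rho> * w)) powr p)"
proof -
  define h where "h = (\<lambda>w. g (of_real \<rho> * w))"
  obtain q :: "nat \<Rightarrow> complex poly"
    where q: "uniform_limit (cball 0 1) (\<lambda>n. poly (q n)) h sequentially"
    using uniform_limit_polys_dilation[OF g \<rho>] unfolding h_def by metis
  have h: "continuous_on (cball 0 1) h"
    unfolding h_def by (rule continuous_on_dilation[OF g \<rho>])
  have "compact (h ` cball 0 1)"
    by (intro compact_continuous_image h) auto
  then obtain B where B: "\<And>w. norm w \<le> 1 \<Longrightarrow> norm (h w) \<le> B"
    by (force simp: bounded_iff dest!: compact_imp_bounded)
  have "uniform_limit (cball 0 1) (\<lambda>n w. norm (poly (q n) w) powr p)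
      (\<lambda>w. norm (h w) powr p) sequentially"
  proof (rule uniform_limit_compose_uniformly_continuous_on[OF q, where B = "cball 0 (B + 1)"])
    show "uniformly_continuous_on (cball 0 (B + 1)) (\<lambda>x::complex. norm x powr p)"
      using \<open>0 < p\<close> by (intro compact_uniformly_continuous continuous_intros) auto
    have "\<forall>\<^sub>F n in sequentially. \<forall>w\<in>cball 0 1. dist (poly (q n) w) (h w) < 1"
      using q by (auto simp: uniform_limit_iff)
    thus "\<forall>\<^sub>F n in sequentially. \<forall>w\<in>cball 0 1. poly (q n) w \<in> cball 0 (B + 1)"
    proof eventually_elim
      case (elim n)
      show ?case
      proof
        fix w :: complex assume w: "w \<in> cball 0 1"
        have "norm (poly (q n) w) \<le> norm (h w) + dist (poly (q n) w) (h w)"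
          by (metis add.commute dist_norm norm_triangle_sub)
        also have "\<dots> \<le> B + 1"
          using elim w B[of w] by fastforce
        finally show "poly (q n) w \<in> cball 0 (B + 1)" by simp
      qed
    qed
  qed simp
  note lim = this
  have "uniform_limit (sphere 0 1) (\<lambda>n w. poisson_kernel z w * norm (poly (q n) w) powr p)
      (\<lambda>w. poisson_kernel z w * norm (h w) powr p) sequentially"
  proof (rule uniform_lim_mult)
    show "uniform_limit (sphere 0 1) (\<lambda>n w. norm (poly (q n) w) powr p)
        (\<lambda>w. norm (h w) powr p) sequentially"
      by (rule uniform_limit_on_subset[OF lim]) auto
    show "bounded (poisson_kernel z ` sphere 0 1)"
      by (intro compact_imp_bounded compact_continuous_image continuous_on_poisson_kernel_circle z) auto
    show "bounded ((\<lambda>w. norm (h w) powr p) ` sphere 0 1)"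
      using \<open>0 < p\<close>
      by (intro compact_imp_bounded compact_continuous_image continuous_intros
          continuous_on_subset[OF h]) auto
  qed (rule uniform_limit_const)
  hence "(\<lambda>n. circle_mean (\<lambda>w. poisson_kernel z w * norm (poly (q n) w) powr p))
      \<longlonglongrightarrow> circle_mean (\<lambda>w. poisson_kernel z w * norm (h w) powr p)"
    using \<open>0 < p\<close>
    by (intro tendsto_circle_mean continuous_intros continuous_on_poisson_kernel_circle z) auto
  moreover have "(\<lambda>n. norm (poly (q n) z) powr p) \<longlonglongrightarrow> norm (h z) powr p"
    using tendsto_uniform_limitI[OF lim, of z] z by simp
  ultimately have "norm (h z) powr p \<le> circle_mean (\<lambda>w. poisson_kernel z w * norm (h w) powr p)"
    using poly_powr_le_poisson_mean[OF \<open>0 < p\<close> z]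
    by (intro LIMSEQ_le) auto
  thus ?thesis by (simp add: h_def)
qed

section \<open>Littlewood subordination in Hardy spaces\<close>

text \<open>
The Poisson kernel is harmonic in its first argument, being the real part of
\<open>(w + z) / (w - z)\<close>, and so is its composition with \<open>\<phi>\<close>; this is its mean value property.
\<close>
lemma circle_mean_poisson_kernel_comp:
  assumes \<phi>: "\<phi> holomorphic_on ball 0 1" "\<phi> ` ball 0 1 \<subseteq> ball 0 1"
    and r: "0 \<le> r" "r < 1" and w: "norm w = 1"
  shows "circle_mean (\<lambda>v. poisson_kernel (\<phi> (of_real r * v)) w) = poisson_kernel (\<phi> 0) w"
proof -
  define F where "F = (\<lambda>v. (w + \<phi> (of_real r * v)) / (w - \<phi> (of_real r * v)))"
  have r': "of_real r * v \<in> ball 0 1" if "norm v \<le> 1" for v :: complex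
    using r mult_left_le[of "norm v" r] that by (simp add: norm_mult)
  have ne: "w \<noteq> \<phi> (of_real r * v)" if "norm v \<le> 1" for v
    using r'[OF that] \<phi>(2) w by fastforce
  have "continuous_on (cball 0 1) F"
    unfolding F_def using ne by (intro continuous_intros continuous_on_dilation \<phi> r) auto
  moreover have "F holomorphic_on ball 0 1"
    unfolding F_def using ne r'
    by (auto intro!: holomorphic_intros holomorphic_on_compose_gen[OF _ \<phi>(1), unfolded o_def])
  ultimately have "circle_mean (\<lambda>v. Re (F v)) = Re (F 0)"
    by (rule circle_mean_Re_holomorphic)
  thus ?thesis by (simp add: F_def poisson_kernel_eq_Re[OF w])
qed

text \<open>
Integrate the Poisson inequality at the points \<open>\<phi> (r v)\<close> over \<open>v\<close> and interchange the two means: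
the inner one collapses to the Poisson kernel at \<open>\<phi> 0\<close>, which is bounded on the circle.
\<close>
lemma littlewood_subordination_dilation:
  assumes p: "0 < p" and g: "g holomorphic_on ball 0 1" and \<rho>: "0 \<le> \<rho>" "\<rho> < 1"
    and \<phi>: "\<phi> holomorphic_on ball 0 1" "\<phi> ` ball 0 1 \<subseteq> ball 0 1" and r: "0 \<le> r" "r < 1"
  shows "circle_mean (\<lambda>v. norm (g (of_real \<rho> * \<phi> (of_real r * v))) powr p) \<le>
    (1 + norm (\<phi> 0)) / (1 - norm (\<phi> 0)) * circle_mean (\<lambda>w. norm (g (of_real \<rho> * w)) powr p)"
proof -
  define h where "h = (\<lambda>w. norm (g (of_real \<rho> * w)) powr p)"
  define f where "f = (\<lambda>v. \<phi> (of_real r * v))"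
  have h: "continuous_on (cball 0 1) h"
    unfolding h_def using p by (intro continuous_intros continuous_on_dilation g \<rho>) auto
  have f: "continuous_on (cball 0 1) f"
    unfolding f_def by (intro continuous_on_dilation \<phi> r)
  have f1: "norm (f v) < 1" if "norm v \<le> 1" for v
  proof -
    have "of_real r * v \<in> ball 0 1"
      using r mult_left_le[of "norm v" r] that by (simp add: norm_mult)
    thus ?thesis using \<phi>(2) by (fastforce simp: f_def)
  qed
  have \<phi>0: "norm (\<phi> 0) < 1" using f1[of 0] by (simp add: f_def)
  have Pf: "continuous_on (sphere 0 1 \<times> sphere 0 1) (\<lambda>(v, w). poisson_kernel (f v) w * h w)"
  proof -
    have "continuous_on (sphere 0 1 \<times> sphere 0 1)
        (\<lambda>x. (\<lambda>(z, w). poisson_kernel z w) (f (fst x), snd x))"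
      by (rule continuous_on_compose2[OF continuous_on_poisson_kernel])
        (auto intro!: continuous_intros continuous_on_compose2[OF f] f1)
    thus ?thesis
      unfolding case_prod_unfold
      by (auto intro!: continuous_intros continuous_on_compose2[OF h])
  qed
  have "circle_mean (\<lambda>v. h (f v)) \<le> circle_mean (\<lambda>v. circle_mean (\<lambda>w. poisson_kernel (f v) w * h w))"
  proof (rule circle_mean_mono)
    show "continuous_on (sphere 0 1) (\<lambda>v. h (f v))"
      using f1 by (intro continuous_on_compose2[OF h] continuous_on_subset[OF f])
        (auto simp: less_imp_le)
    show "continuous_on (sphere 0 1) (\<lambda>v. circle_mean (\<lambda>w. poisson_kernel (f v) w * h w))"
      by (rule continuous_on_circle_mean_param[OF Pf])
    fix v :: complex assume "norm v = 1"
    thus "h (f v) \<le> circle_mean (\<lambda>w. poisson_kernel (f v) w * h w)"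
      unfolding h_def using f1[of v] by (intro dilation_powr_le_poisson_mean p g \<rho>) auto
  qed
  also have "\<dots> = circle_mean (\<lambda>w. circle_mean (\<lambda>v. poisson_kernel (f v) w * h w))"
    by (rule circle_mean_swap[OF Pf])
  also have "\<dots> = circle_mean (\<lambda>w. poisson_kernel (\<phi> 0) w * h w)"
  proof -
    have "circle_mean (\<lambda>v. poisson_kernel (f v) w * h w) = poisson_kernel (\<phi> 0) w * h w"
      if "norm w = 1" for w
      using circle_mean_poisson_kernel_comp[OF \<phi> r that]
        circle_mean_cmult[of "h w" "\<lambda>v. poisson_kernel (f v) w"]
      by (simp add: f_def mult.commute)
    thus ?thesis by (simp add: circle_mean_def)
  qed
  also have "\<dots> \<le> circle_mean (\<lambda>w. (1 + norm (\<phi> 0)) / (1 - norm (\<phi> 0)) * h w)"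
  proof (rule circle_mean_mono)
    show "continuous_on (sphere 0 1) (\<lambda>w. poisson_kernel (\<phi> 0) w * h w)"
      by (intro continuous_intros continuous_on_poisson_kernel_circle \<phi>0 continuous_on_subset[OF h]) auto
    show "continuous_on (sphere 0 1) (\<lambda>w. (1 + norm (\<phi> 0)) / (1 - norm (\<phi> 0)) * h w)"
      by (intro continuous_intros continuous_on_subset[OF h]) (use \<phi>0 in auto)
    show "poisson_kernel (\<phi> 0) w * h w \<le> (1 + norm (\<phi> 0)) / (1 - norm (\<phi> 0)) * h w"
      if "norm w = 1" for w
      by (intro mult_right_mono poisson_kernel_bound \<phi>0 that) (simp add: h_def)
  qed
  finally show ?thesis
    by (simp only: circle_mean_cmult h_def f_def)
qed

lemma hardy_space_iff:
  "f \<in> hardy_space p \<longleftrightarrow> f \<in> extensional \<bbbD> \<and> f holomorphic_on \<bbbD> \<and>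
    (\<exists>M. \<forall>r. 0 \<le> r \<and> r < 1 \<longrightarrow> circle_mean (\<lambda>w. norm (f (of_real r * w)) powr p) \<le> M)"
  unfolding hardy_space_def circle_mean_def bdd_above_def
  by simp (auto simp: Ball_def)

text \<open>
This is Littlewood's subordination theorem. The dilation parameter tends to \<open>1\<close>
for each fixed radius \<open>r\<close>; this is harmless because \<open>\<phi>\<close> maps the circle of radius \<open>r\<close> to a
compact subset of the disk.
\<close>
lemma hardy_space_comp:
  assumes p: "0 < p" and g: "g \<in> hardy_space p"
    and \<phi>: "\<phi> holomorphic_on \<bbbD>" "\<phi> ` \<bbbD> \<subseteq> \<bbbD>"
  shows "restrict (g \<circ> \<phi>) \<bbbD> \<in> hardy_space p"
proof -
  from g obtain M where hol: "g holomorphic_on \<bbbD>"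
    and M: "\<And>r. 0 \<le> r \<Longrightarrow> r < 1 \<Longrightarrow> circle_mean (\<lambda>w. norm (g (of_real r * w)) powr p) \<le> M"
    unfolding hardy_space_iff by blast
  define C where "C = (1 + norm (\<phi> 0)) / (1 - norm (\<phi> 0))"
  have "norm (\<phi> 0) < 1" using \<phi>(2) by force
  hence "0 \<le> C" by (simp add: C_def)
  have bound: "circle_mean (\<lambda>v. norm (g (\<phi> (of_real r * v))) powr p) \<le> C * M"
    if r: "0 \<le> r" "r < 1" for r
  proof (rule tendsto_upperbound)
    define u where "u = (\<lambda>\<rho> v. norm (g (of_real \<rho> * \<phi> (of_real r * v))) powr p)"
    have rv: "of_real r * v \<in> \<bbbD>" if "norm v = 1" for v :: complex
      using r that by (simp add: norm_mult)
    have "continuous_on {0..1} (\<lambda>\<rho>. circle_mean (u \<rho>))"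
    proof (rule continuous_on_circle_mean_param)
      have "of_real \<rho> * \<phi> (of_real r * v) \<in> \<bbbD>" if "0 \<le> \<rho>" "\<rho> \<le> 1" "norm v = 1" for \<rho> v
      proof -
        have "norm (\<phi> (of_real r * v)) < 1" using \<phi>(2) rv[OF that(3)] by fastforce
        thus ?thesis
          using that mult_left_le_one_le[of "norm (\<phi> (of_real r * v))" \<rho>] by (simp add: norm_mult)
      qed
      thus "continuous_on ({0..1} \<times> sphere 0 1) (\<lambda>(\<rho>, v). u \<rho> v)"
        unfolding u_def case_prod_unfold using p rv
        by (auto intro!: continuous_intros
            continuous_on_compose2[OF holomorphic_on_imp_continuous_on[OF hol]]
            continuous_on_compose2[OF holomorphic_on_imp_continuous_on[OF \<phi>(1)]])
    qed
    hence "((\<lambda>\<rho>. circle_mean (u \<rho>)) \<longlongrightarrow> circle_mean (u 1)) (at 1 within {0..1})"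
      by (auto simp: continuous_on_def)
    thus "((\<lambda>\<rho>. circle_mean (u \<rho>)) \<longlongrightarrow> circle_mean (\<lambda>v. norm (g (\<phi> (of_real r * v))) powr p))
        (at_left 1)"
      by (simp add: u_def at_within_Icc_at_left)
    have "\<forall>\<^sub>F \<rho> in at_left 1. \<rho> \<in> {0<..<1::real}"
      by (rule eventually_at_left_real) simp
    thus "\<forall>\<^sub>F \<rho> in at_left 1. circle_mean (u \<rho>) \<le> C * M"
    proof eventually_elim
      case (elim \<rho>)
      have "circle_mean (u \<rho>) \<le> C * circle_mean (\<lambda>w. norm (g (of_real \<rho> * w)) powr p)"
        unfolding u_def C_def using elim
        by (intro littlewood_subordination_dilation p hol \<phi> r) auto
      also have "\<dots> \<le> C * M"
        using elim by (intro mult_left_mono M \<open>0 \<le> C\<close>) auto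
      finally show ?case .
    qed
  qed simp
  have "circle_mean (\<lambda>v. norm (restrict (g \<circ> \<phi>) \<bbbD> (of_real r * v)) powr p) \<le> C * M"
    if "0 \<le> r" "r < 1" for r
    using bound[OF that] that by (simp add: circle_mean_def norm_mult)
  moreover have "restrict (g \<circ> \<phi>) \<bbbD> holomorphic_on \<bbbD>"
    using holomorphic_on_compose_gen[OF \<phi>(1) hol \<phi>(2)] by (rule holomorphic_transform) simp
  ultimately show ?thesis
    unfolding hardy_space_iff by blast
qed

lemma hardy_space_bounded_mult:
  assumes p: "0 < p" and g: "g \<in> hardy_space p"
    and u: "u holomorphic_on \<bbbD>" "\<And>z. z \<in> \<bbbD> \<Longrightarrow> norm (u z) \<le> B"
  shows "(\<lambda>z\<in>\<bbbD>. u z * g z) \<in> hardy_space p"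
proof -
  from g obtain M where hol: "g holomorphic_on \<bbbD>"
    and M: "\<And>r. 0 \<le> r \<Longrightarrow> r < 1 \<Longrightarrow> circle_mean (\<lambda>w. norm (g (of_real r * w)) powr p) \<le> M"
    unfolding hardy_space_iff by blast
  have B: "0 \<le> B" using u(2)[of 0] norm_ge_zero[of "u 0"] by (simp del: norm_ge_zero)
  have "circle_mean (\<lambda>w. norm (restrict (\<lambda>z. u z * g z) \<bbbD> (of_real r * w)) powr p) \<le> B powr p * M"
    if r: "0 \<le> r" "r < 1" for r
  proof -
    have rw: "of_real r * w \<in> \<bbbD>" if "norm w = 1" for w :: complex
      using r that by (simp add: norm_mult)
    have "circle_mean (\<lambda>w. norm (restrict (\<lambda>z. u z * g z) \<bbbD> (of_real r * w)) powr p) =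
        circle_mean (\<lambda>w. norm (u (of_real r * w)) powr p * norm (g (of_real r * w)) powr p)"
      using r by (simp add: circle_mean_def norm_mult powr_mult)
    also have "\<dots> \<le> circle_mean (\<lambda>w. B powr p * norm (g (of_real r * w)) powr p)"
      using p rw
      by (intro circle_mean_mono mult_right_mono powr_mono2 u continuous_intros
          continuous_on_subset[OF continuous_on_dilation[OF hol]]
          continuous_on_subset[OF continuous_on_dilation[OF u(1)]] r) auto
    also have "\<dots> \<le> B powr p * M"
      unfolding circle_mean_cmult by (intro mult_left_mono M r) auto
    finally show ?thesis .
  qed
  moreover have "(\<lambda>z\<in>\<bbbD>. u z * g z) holomorphic_on \<bbbD>"
    using holomorphic_on_mult[OF u(1) hol] by (rule holomorphic_transform) simp
  ultimately show ?thesis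
    unfolding hardy_space_iff by blast
qed

section \<open>The spaces of functions with derivative in a Hardy space\<close>

lemma deriv_restrict_disk: "z \<in> \<bbbD> \<Longrightarrow> deriv (restrict f \<bbbD>) z = deriv f z"
  by (intro deriv_cong_ev eventually_mono[OF eventually_nhds_in_open[of \<bbbD>]]) auto

lemma restrict_in_S_space_iff:
  "restrict f \<bbbD> \<in> S_space p \<longleftrightarrow> f holomorphic_on \<bbbD> \<and> restrict (deriv f) \<bbbD> \<in> hardy_space p"
proof -
  have "restrict (deriv (restrict f \<bbbD>)) \<bbbD> = restrict (deriv f) \<bbbD>"
    by (intro restrict_ext deriv_restrict_disk)
  moreover have "restrict f \<bbbD> holomorphic_on \<bbbD> \<longleftrightarrow> f holomorphic_on \<bbbD>"
    by (intro holomorphic_cong) auto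
  ultimately show ?thesis by (simp add: S_space_def)
qed

lemma bounded_deriv_imp_S_space:
  assumes p: "0 < p" and f: "f holomorphic_on \<bbbD>" and bound: "\<And>z. z \<in> \<bbbD> \<Longrightarrow> norm (deriv f z) \<le> B"
  shows "restrict f \<bbbD> \<in> S_space p"
proof -
  have "(\<lambda>z\<in>\<bbbD>. 1) \<in> hardy_space p"
    unfolding hardy_space_iff
  proof (intro conjI exI[of _ 1] allI impI)
    have "(\<lambda>_. 1) holomorphic_on \<bbbD>" by simp
    thus "(\<lambda>z\<in>\<bbbD>. 1) holomorphic_on \<bbbD>" by (rule holomorphic_transform) simp
  qed (simp_all add: circle_mean_def norm_mult)
  from hardy_space_bounded_mult[OF p this holomorphic_deriv[OF f] bound]
  have "(\<lambda>z\<in>\<bbbD>. deriv f z * (\<lambda>z\<in>\<bbbD>. 1) z) \<in> hardy_space p" by simp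
  also have "(\<lambda>z\<in>\<bbbD>. deriv f z * (\<lambda>z\<in>\<bbbD>. 1) z) = restrict (deriv f) \<bbbD>"
    by (intro restrict_ext) simp
  finally show ?thesis
    unfolding restrict_in_S_space_iff using f by blast
qed

section \<open>Automorphisms of the disk\<close>

lemma disk_automorphism_inverse:
  assumes "disk_automorphism \<phi>"
  obtains \<phi>' where "disk_automorphism \<phi>'"
    "\<And>z. z \<in> \<bbbD> \<Longrightarrow> \<phi>' (\<phi> z) = z" "\<And>z. z \<in> \<bbbD> \<Longrightarrow> \<phi> (\<phi>' z) = z"
proof -
  have \<phi>: "\<phi> holomorphic_on \<bbbD>" "inj_on \<phi> \<bbbD>" "\<phi> ` \<bbbD> = \<bbbD>"
    using assms by (auto simp: disk_automorphism_def bij_betw_def)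
  obtain \<phi>' where \<phi>': "\<phi>' holomorphic_on (\<phi> ` \<bbbD>)" "\<And>z. z \<in> \<bbbD> \<Longrightarrow> \<phi>' (\<phi> z) = z"
    using holomorphic_has_inverse[OF \<phi>(1) open_ball \<phi>(2)] by metis
  have inv: "\<phi> (\<phi>' z) = z" "\<phi>' z \<in> \<bbbD>" if "z \<in> \<bbbD>" for z
    using that \<phi>(3) \<phi>'(2) by (metis imageE)+
  have "\<phi> z \<in> \<bbbD>" if "z \<in> \<bbbD>" for z
    using that \<phi>(3) by blast
  hence "bij_betw \<phi>' \<bbbD> \<bbbD>"
    using inv \<phi>'(2) by (intro bij_betwI[where g = \<phi>]) blast+
  with that inv \<phi>' \<phi>(3) show ?thesis
    by (simp add: disk_automorphism_def)
qed

text \<open>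
After a Moebius map has moved the zero of \<open>\<phi>\<close> to \<open>0\<close>, the Schwarz lemma applies to the resulting
automorphism and to its inverse, so that it preserves moduli and is a rotation.
\<close>
lemma disk_automorphism_eq_Moebius:
  assumes "disk_automorphism \<phi>"
  obtains \<alpha> a where "norm a < 1" "norm \<alpha> = 1" "\<And>z. z \<in> \<bbbD> \<Longrightarrow> \<phi> z = \<alpha> * Moebius_function 0 a z"
proof -
  obtain \<phi>' where \<phi>': "disk_automorphism \<phi>'"
    "\<And>z. z \<in> \<bbbD> \<Longrightarrow> \<phi>' (\<phi> z) = z" "\<And>z. z \<in> \<bbbD> \<Longrightarrow> \<phi> (\<phi>' z) = z"
    using disk_automorphism_inverse[OF assms] by metis
  have maps: "\<phi> z \<in> \<bbbD>" "\<phi>' z \<in> \<bbbD>" if "z \<in> \<bbbD>" for z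
    using assms \<phi>'(1) that unfolding disk_automorphism_def bij_betw_def by blast+
  have hol: "\<phi> holomorphic_on \<bbbD>" "\<phi>' holomorphic_on \<bbbD>"
    using assms \<phi>'(1) by (auto simp: disk_automorphism_def)
  define a where "a = \<phi>' 0"
  define m n where "m = Moebius_function 0 a" and "n = Moebius_function 0 (- a)"
  have a: "norm a < 1" "\<phi> a = 0"
    using maps(2)[of 0] \<phi>'(3)[of 0] by (simp_all add: a_def)
  have mn: "m z \<in> \<bbbD>" "n z \<in> \<bbbD>" "m (n z) = z" "n (m z) = z" if "z \<in> \<bbbD>" for z
    using a(1) that by (simp_all add: m_def n_def Moebius_function_norm_lt_1 Moebius_function_compose)
  have hol_mn: "m holomorphic_on \<bbbD>" "n holomorphic_on \<bbbD>"
    using a(1) by (simp_all add: m_def n_def Moebius_function_holomorphic)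
  define h where "h = \<phi> \<circ> n"
  define h' where "h' = m \<circ> \<phi>'"
  have h: "h holomorphic_on \<bbbD>" "h 0 = 0" "\<And>z. norm z < 1 \<Longrightarrow> norm (h z) < 1"
    unfolding h_def using maps mn(2) a(2)
    by (auto simp: n_def[THEN fun_cong] Moebius_function_of_zero
        intro!: holomorphic_on_compose_gen[OF hol_mn(2) hol(1)])
  have h': "h' holomorphic_on \<bbbD>" "h' 0 = 0" "\<And>z. norm z < 1 \<Longrightarrow> norm (h' z) < 1"
    unfolding h'_def using maps mn(1)
    by (auto simp: m_def[THEN fun_cong] a_def[symmetric] Moebius_function_eq_zero
        intro!: holomorphic_on_compose_gen[OF hol(2) hol_mn(1)])
  \<comment> \<open>The Schwarz lemma for \<open>h\<close> gives one inequality, for its inverse \<open>h'\<close> the other.\<close>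
  have "norm (h z) = norm z" if z: "norm z < 1" for z
  proof (rule antisym)
    show "norm (h z) \<le> norm z"
      by (rule Schwarz_Lemma(1)[OF h z])
    have "norm (h' (h z)) \<le> norm (h z)"
      by (rule Schwarz_Lemma(1)[OF h' h(3)[OF z]])
    thus "norm z \<le> norm (h z)"
      using z \<phi>'(2) mn by (simp add: h_def h'_def)
  qed
  \<comment> \<open>Any point of the disk other than the origin will do for the equality case.\<close>
  hence "norm (1/2 :: complex) < 1 \<and> (1/2 :: complex) \<noteq> 0 \<and> norm (h (1/2)) = norm (1/2 :: complex)"
    by simp
  then obtain \<alpha> where \<alpha>: "\<And>z. norm z < 1 \<Longrightarrow> h z = \<alpha> * z" "norm \<alpha> = 1"
    using Schwarz_Lemma(3)[OF h, of 0] by (metis norm_zero zero_less_one)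
  have "\<phi> z = \<alpha> * m z" if "z \<in> \<bbbD>" for z
    using \<alpha>(1)[of "m z"] mn[OF that] by (simp add: h_def)
  with that a(1) \<alpha>(2) show ?thesis by (simp add: m_def)
qed

text \<open>
The pole \<open>1 / cnj a\<close> of the Moebius map lies outside the closed disk, so its derivative extends
continuously to the circle.
\<close>
lemma disk_automorphism_deriv_bounded:
  assumes "disk_automorphism \<phi>"
  obtains B where "\<And>z. z \<in> \<bbbD> \<Longrightarrow> norm (deriv \<phi> z) \<le> B"
proof -
  obtain \<alpha> a where a: "norm a < 1" and \<alpha>: "norm \<alpha> = 1"
    and eq: "\<And>z. z \<in> \<bbbD> \<Longrightarrow> \<phi> z = \<alpha> * Moebius_function 0 a z"
    using disk_automorphism_eq_Moebius[OF assms] by metis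
  have "norm (deriv \<phi> z) \<le> (1 - (norm a)\<^sup>2) / (1 - norm a)\<^sup>2" if z: "z \<in> \<bbbD>" for z
  proof -
    have "norm (cnj a * z) \<le> norm a"
      using z by (simp add: norm_mult mult_left_le)
    hence lower: "1 - norm a \<le> norm (1 - cnj a * z)"
      using norm_triangle_ineq2[of 1 "cnj a * z"] by simp
    hence nz: "1 - cnj a * z \<noteq> 0" using a by auto
    have "deriv \<phi> z = deriv (\<lambda>z. \<alpha> * ((z - a) / (1 - cnj a * z))) z"
      using z eq by (intro deriv_cong_ev eventually_mono[OF eventually_nhds_in_open[of \<bbbD>]])
        (auto simp: Moebius_function_simple)
    also have "\<dots> = \<alpha> * ((1 - cnj a * z + (z - a) * cnj a) / (1 - cnj a * z)\<^sup>2)"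
      using nz by (intro DERIV_imp_deriv)
        (auto intro!: derivative_eq_intros simp: power2_eq_square distrib_left)
    also have "1 - cnj a * z + (z - a) * cnj a = 1 - a * cnj a"
      by (simp add: algebra_simps)
    also have "\<dots> = of_real (1 - (norm a)\<^sup>2)"
      by (simp only: of_real_diff of_real_1 complex_norm_square)
    finally have "norm (deriv \<phi> z) = (1 - (norm a)\<^sup>2) / (norm (1 - cnj a * z))\<^sup>2"
      using \<alpha> a by (simp only: norm_mult norm_divide norm_power norm_of_real) (simp add: power_le_one)
    also have "\<dots> \<le> (1 - (norm a)\<^sup>2) / (1 - norm a)\<^sup>2"
      using a lower nz by (intro divide_left_mono power_mono mult_pos_pos) (auto simp: power_le_one)
    finally show ?thesis .
  qed
  thus ?thesis by (rule that)
qed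

section \<open>Invertible operators from automorphisms and multipliers\<close>

text \<open>
By the chain rule \<open>(f \<circ> \<phi>)' = \<phi>' * (f' \<circ> \<phi>)\<close>: Littlewood's theorem handles the second factor and
the first is bounded.
\<close>
lemma comp_op_in_S_space:
  assumes p: "0 < p" and \<phi>: "disk_automorphism \<phi>" and f: "f \<in> S_space p"
  shows "comp_op \<phi> f \<in> S_space p"
proof -
  have hol: "\<phi> holomorphic_on \<bbbD>" and maps: "\<phi> ` \<bbbD> \<subseteq> \<bbbD>"
    using \<phi> by (auto simp: disk_automorphism_def bij_betw_def)
  have f': "f holomorphic_on \<bbbD>" "restrict (deriv f) \<bbbD> \<in> hardy_space p"
    using f by (auto simp: S_space_def)
  obtain B where "\<And>z. z \<in> \<bbbD> \<Longrightarrow> norm (deriv \<phi> z) \<le> B"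
    using disk_automorphism_deriv_bounded[OF \<phi>] by metis
  from hardy_space_bounded_mult[OF p hardy_space_comp[OF p f'(2) hol maps] holomorphic_deriv[OF hol] this]
  have "(\<lambda>z\<in>\<bbbD>. deriv \<phi> z * restrict (restrict (deriv f) \<bbbD> \<circ> \<phi>) \<bbbD> z) \<in> hardy_space p"
    by simp
  also have "(\<lambda>z\<in>\<bbbD>. deriv \<phi> z * restrict (restrict (deriv f) \<bbbD> \<circ> \<phi>) \<bbbD> z) = restrict (deriv (f \<circ> \<phi>)) \<bbbD>"
  proof (intro restrict_ext)
    fix z assume z: "z \<in> \<bbbD>"
    hence "\<phi> z \<in> \<bbbD>" using maps by blast
    moreover have "deriv (f \<circ> \<phi>) z = deriv f (\<phi> z) * deriv \<phi> z"
      using z \<open>\<phi> z \<in> \<bbbD>\<close> hol f'(1)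
      by (intro deriv_chain) (auto intro: holomorphic_on_imp_differentiable_at)
    ultimately show "deriv \<phi> z * restrict (restrict (deriv f) \<bbbD> \<circ> \<phi>) \<bbbD> z = deriv (f \<circ> \<phi>) z"
      using z by simp
  qed
  finally have "restrict (f \<circ> \<phi>) \<bbbD> \<in> S_space p"
    unfolding restrict_in_S_space_iff
    using holomorphic_on_compose_gen[OF hol f'(1) maps] by blast
  thus ?thesis by (simp add: comp_op_def o_def)
qed

lemma invertible_on_S_I:
  assumes "\<And>f. f \<in> S_space p \<Longrightarrow> T f \<in> S_space p" "\<And>f. f \<in> S_space p \<Longrightarrow> T' f \<in> S_space p"
    and "\<And>f. f \<in> S_space p \<Longrightarrow> T' (T f) = f" "\<And>f. f \<in> S_space p \<Longrightarrow> T (T' f) = f"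
  shows "invertible_on_S p T"
  unfolding invertible_on_S_def using assms by (auto intro: bij_betwI[where g = T'])

lemma S_space_eqI:
  assumes "f \<in> S_space p" "\<And>z. z \<in> \<bbbD> \<Longrightarrow> g z = f z" "g \<in> extensional \<bbbD>"
  shows "g = f"
  using assms by (intro extensionalityI[where A = \<bbbD>]) (auto simp: S_space_def)

lemma comp_op_invertible:
  assumes p: "0 < p" and \<phi>: "disk_automorphism \<phi>"
  shows "invertible_on_S p (comp_op \<phi>)"
proof -
  obtain \<phi>' where \<phi>': "disk_automorphism \<phi>'"
    "\<And>z. z \<in> \<bbbD> \<Longrightarrow> \<phi>' (\<phi> z) = z" "\<And>z. z \<in> \<bbbD> \<Longrightarrow> \<phi> (\<phi>' z) = z"
    using disk_automorphism_inverse[OF \<phi>] by metis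
  have maps: "\<phi> z \<in> \<bbbD>" "\<phi>' z \<in> \<bbbD>" if "z \<in> \<bbbD>" for z
    using \<phi> \<phi>'(1) that unfolding disk_automorphism_def bij_betw_def by blast+
  show ?thesis
  proof (rule invertible_on_S_I[where T' = "comp_op \<phi>'"])
    fix f assume f: "f \<in> S_space p"
    show "comp_op \<phi>' (comp_op \<phi> f) = f" "comp_op \<phi> (comp_op \<phi>' f) = f"
      by (rule S_space_eqI[OF f]; use \<phi>' maps in \<open>simp add: comp_op_def\<close>)+
  qed (intro comp_op_in_S_space p \<phi> \<phi>'; assumption)+
qed

lemma multiplication_invertible:
  assumes "S_multiplier p \<psi>" "reciprocal_S_multiplier p \<psi>"
  shows "invertible_on_S p (\<lambda>f. \<lambda>z\<in>\<bbbD>. \<psi> z * f z)"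
proof (rule invertible_on_S_I[where T' = "\<lambda>f. \<lambda>z\<in>\<bbbD>. 1 / \<psi> z * f z"])
  fix f assume f: "f \<in> S_space p"
  show "(\<lambda>z\<in>\<bbbD>. 1 / \<psi> z * (\<lambda>z\<in>\<bbbD>. \<psi> z * f z) z) = f"
    "(\<lambda>z\<in>\<bbbD>. \<psi> z * (\<lambda>z\<in>\<bbbD>. 1 / \<psi> z * f z) z) = f"
    by (rule S_space_eqI[OF f]; use assms in \<open>simp add: reciprocal_S_multiplier_def\<close>)+
qed (use assms in \<open>auto simp: S_multiplier_def reciprocal_S_multiplier_def\<close>)

lemma invertible_on_S_comp:
  assumes "invertible_on_S p T" "invertible_on_S p U"
  shows "invertible_on_S p (T \<circ> U)"
  using assms unfolding invertible_on_S_def by (auto intro: bij_betw_trans)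

lemma weighted_comp_op_eq:
  assumes "\<phi> ` \<bbbD> \<subseteq> \<bbbD>"
  shows "weighted_comp_op \<psi> \<phi> = (\<lambda>f. \<lambda>z\<in>\<bbbD>. \<psi> z * f z) \<circ> comp_op \<phi>"
  by (auto simp: weighted_comp_op_def comp_op_def fun_eq_iff)

text \<open>
Since \<open>C\<^sub>\<phi>\<close> is onto, the image of the space under multiplication by \<open>\<psi>\<close> is its image under the
weighted composition operator, hence the whole space. So \<open>\<psi>\<close> is a multiplier, and every
function of the space is divisible by \<open>\<psi>\<close> within the space.
\<close>
lemma multipliers_of_invertible_weighted_comp_op:
  assumes p: "0 < p" and \<phi>: "disk_automorphism \<phi>" and inv: "invertible_on_S p (weighted_comp_op \<psi> \<phi>)"
  shows "S_multiplier p \<psi>" "reciprocal_S_multiplier p \<psi>"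
proof -
  have maps: "\<phi> ` \<bbbD> \<subseteq> \<bbbD>"
    using \<phi> by (auto simp: disk_automorphism_def bij_betw_def)
  have C: "comp_op \<phi> ` S_space p = S_space p" and W: "weighted_comp_op \<psi> \<phi> ` S_space p = S_space p"
    using inv comp_op_invertible[OF p \<phi>] by (auto simp: invertible_on_S_def bij_betw_def)
  have image: "(\<lambda>f. \<lambda>z\<in>\<bbbD>. \<psi> z * f z) ` S_space p = S_space p"
    using W unfolding weighted_comp_op_eq[OF maps] image_comp[symmetric] C .
  show "S_multiplier p \<psi>"
    unfolding S_multiplier_def
  proof
    fix f assume "f \<in> S_space p"
    from imageI[OF this, of "\<lambda>f. \<lambda>z\<in>\<bbbD>. \<psi> z * f z"]
    show "(\<lambda>z\<in>\<bbbD>. \<psi> z * f z) \<in> S_space p"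
      by (simp only: image)
  qed
  have div: "\<exists>g\<in>S_space p. \<forall>z\<in>\<bbbD>. h z = \<psi> z * g z" if "h \<in> S_space p" for h
  proof -
    from that have "h \<in> (\<lambda>f. \<lambda>z\<in>\<bbbD>. \<psi> z * f z) ` S_space p"
      by (simp only: image)
    then obtain g where g: "g \<in> S_space p" "h = (\<lambda>z\<in>\<bbbD>. \<psi> z * g z)"
      by (rule imageE)
    have "\<forall>z\<in>\<bbbD>. h z = \<psi> z * g z" unfolding g(2) by simp
    with g(1) show ?thesis by blast
  qed
  have "(\<lambda>z\<in>\<bbbD>. 1) \<in> S_space p"
    by (rule bounded_deriv_imp_S_space[OF p, where B = 0]) simp_all
  from div[OF this] have nz: "\<psi> z \<noteq> 0" if "z \<in> \<bbbD>" for z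
    using that by force
  moreover have "S_multiplier p (\<lambda>z. 1 / \<psi> z)"
    unfolding S_multiplier_def
  proof
    fix h assume "h \<in> S_space p"
    from div[OF this] obtain g where g: "g \<in> S_space p" "\<And>z. z \<in> \<bbbD> \<Longrightarrow> h z = \<psi> z * g z"
      by blast
    have "(\<lambda>z\<in>\<bbbD>. 1 / \<psi> z * h z) = g"
      by (rule S_space_eqI[OF g(1)]) (use nz g(2) in simp_all)
    thus "(\<lambda>z\<in>\<bbbD>. 1 / \<psi> z * h z) \<in> S_space p" using g(1) by simp
  qed
  ultimately show "reciprocal_S_multiplier p \<psi>"
    by (simp add: reciprocal_S_multiplier_def)
qed

section \<open>Automorphisms from surjective operators\<close>

text \<open>
Formally \<open>C / B\<close> is a \<open>K\<close>-th root of \<open>B / A\<close>. Such a root can be meromorphic at \<open>b\<close> only if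
\<open>K\<close> divides the order of \<open>B / A\<close> there.
\<close>
lemma dvd_zorder_diff:
  assumes hol: "A holomorphic_on S" "B holomorphic_on S" "C holomorphic_on S"
    and S: "open S" "connected S" "b \<in> S"
    and nz: "\<exists>u\<in>S. A u \<noteq> 0" "\<exists>u\<in>S. B u \<noteq> 0"
    and K: "0 < K" and eq: "\<And>u. u \<in> S \<Longrightarrow> C u ^ K * A u = B u ^ (K + 1)"
  shows "int K dvd zorder B b - zorder A b"
proof -
  have ev: "\<forall>\<^sub>F u in at b. f u \<noteq> 0" if "f holomorphic_on S" "\<exists>u\<in>S. f u \<noteq> 0" for f
  proof -
    from that(2) obtain u where "u \<in> S" "f u \<noteq> 0" by blast
    from non_zero_neighbour_alt[OF that(1) S this]
    show ?thesis by (rule eventually_mono) simp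
  qed
  have A: "A analytic_on {b}" and B: "B analytic_on {b}" and C: "C analytic_on {b}"
    using hol S by (auto simp: analytic_at)
  have evA: "\<forall>\<^sub>F u in at b. A u \<noteq> 0" and evB: "\<forall>\<^sub>F u in at b. B u \<noteq> 0"
    using ev hol nz by blast+
  have evS: "\<forall>\<^sub>F u in at b. u \<in> S"
    using S by (intro eventually_at_in_open') auto
  have evC: "\<forall>\<^sub>F u in at b. C u \<noteq> 0"
    using evB evS
  proof eventually_elim
    case (elim u)
    thus ?case using eq[of u] K by (auto simp: power_0_left)
  qed
  have mero: "f meromorphic_on {b}" if "f analytic_on {b}" for f
    using that by (rule analytic_on_imp_meromorphic_on)
  have "zorder (\<lambda>u. C u ^ K * A u) b = zorder (\<lambda>u. C u ^ K) b + zorder A b"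
    using evA evC by (intro zorder_times_analytic analytic_intros A C; eventually_elim) auto
  also have "zorder (\<lambda>u. C u ^ K) b = int K * zorder C b"
    using evC by (intro zorder_power mero C eventually_frequently) auto
  also have "zorder (\<lambda>u. C u ^ K * A u) b = zorder (\<lambda>u. B u ^ (K + 1)) b"
    using eq by (intro zorder_cong eventually_mono[OF evS] refl) simp
  also have "\<dots> = int (K + 1) * zorder B b"
    using evB by (intro zorder_power mero B eventually_frequently) auto
  finally have "zorder B b - zorder A b = int K * (zorder C b - zorder B b)"
    by (simp add: algebra_simps)
  thus ?thesis by simp
qed

text \<open>
If the orders agreed, the common power of \<open>u - b\<close> would cancel in the quotient, which would
then have a nonzero limit at \<open>b\<close>.
\<close>
lemma zorder_neq_of_quotient_tendsto_0:
  assumes hol: "A holomorphic_on S" "B holomorphic_on S"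
    and S: "open S" "connected S" "b \<in> S"
    and nz: "\<exists>u\<in>S. A u \<noteq> 0" "\<exists>u\<in>S. B u \<noteq> 0"
    and x: "x \<longlonglongrightarrow> b" "\<And>n. x n \<noteq> b" and lim: "(\<lambda>n. B (x n) / A (x n)) \<longlonglongrightarrow> 0"
  shows "zorder A b \<noteq> zorder B b"
proof
  assume eq: "zorder A b = zorder B b"
  define g h where "g = zor_poly A b" and "h = zor_poly B b"
  obtain r where r: "0 < r" "g holomorphic_on cball b r"
      "\<And>w. w \<in> cball b r \<Longrightarrow> A w = g w * (w - b) ^ nat (zorder A b) \<and> g w \<noteq> 0"
    using zorder_exist_zero[OF hol(1) S nz(1)] unfolding g_def by blast
  obtain s where s: "0 < s" "h holomorphic_on cball b s"
      "\<And>w. w \<in> cball b s \<Longrightarrow> B w = h w * (w - b) ^ nat (zorder B b) \<and> h w \<noteq> 0"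
    using zorder_exist_zero[OF hol(2) S nz(2)] unfolding h_def by blast
  have cont: "isCont f b" if "0 < t" "f holomorphic_on cball b t" for f :: "complex \<Rightarrow> complex" and t
    by (rule continuous_on_interior[OF holomorphic_on_imp_continuous_on[OF that(2)]]) (use that(1) in simp)
  have "isCont g b" "isCont h b"
    by (rule cont[OF r(1,2)], rule cont[OF s(1,2)])
  hence "(\<lambda>n. h (x n) / g (x n)) \<longlonglongrightarrow> h b / g b"
    using r(1) r(3)[of b] x(1)
    by (intro tendsto_divide isCont_tendsto_compose[of b g] isCont_tendsto_compose[of b h]) simp_all
  moreover have "\<forall>\<^sub>F n in sequentially. x n \<in> ball b (min r s)"
    using x(1) r(1) s(1) by (intro topological_tendstoD) auto
  hence "\<forall>\<^sub>F n in sequentially. B (x n) / A (x n) = h (x n) / g (x n)"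
    by eventually_elim (use r(3) s(3) x(2) eq in auto)
  ultimately have "(\<lambda>n. B (x n) / A (x n)) \<longlonglongrightarrow> h b / g b"
    by (simp add: tendsto_cong)
  hence "h b / g b = 0"
    using lim by (rule LIMSEQ_unique)
  thus False using r(1) r(3)[of b] s(1) s(3)[of b] by simp
qed

text \<open>
When \<open>\<bar>c\<bar> = 1\<close>, this function has a branch point on the circle unless \<open>s\<close> is an integer; an
exponent of at least \<open>1\<close> still keeps its derivative bounded.
\<close>
lemma boundary_root_in_S_space:
  assumes p: "0 < p" and c: "norm c \<le> 1" and s: "1 \<le> s"
  shows "(\<lambda>z\<in>\<bbbD>. (1 - c * z) powr of_real s) \<in> S_space p"
proof (rule bounded_deriv_imp_S_space[OF p, where B = "s * 2 powr (s - 1)"])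
  show "(\<lambda>z. (1 - c * z) powr of_real s) holomorphic_on \<bbbD>"
    using s by (intro linear_factor_power c) auto
  fix z assume z: "z \<in> \<bbbD>"
  have cz: "norm (c * z) < 1"
    using c z mult_left_le_one_le[of "norm z" "norm c"] by (simp add: norm_mult)
  have "Re (c * z) < 1"
    using complex_Re_le_cmod[of "c * z"] cz by linarith
  hence "1 - c * z \<notin> \<real>\<^sub>\<le>\<^sub>0"
    by (auto simp: complex_nonpos_Reals_iff)
  hence "((\<lambda>z. (1 - c * z) powr of_real s) has_field_derivative
      of_real s * (1 - c * z) powr of_real (s - 1) * (- c)) (at z)"
    by (auto intro!: derivative_eq_intros has_field_derivative_powr[THEN DERIV_chain2])
  hence "norm (deriv (\<lambda>z. (1 - c * z) powr of_real s) z) = s * norm (1 - c * z) powr (s - 1) * norm c"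
    using s by (simp only: DERIV_imp_deriv norm_mult norm_powr_of_real) simp
  also have "\<dots> \<le> s * 2 powr (s - 1) * 1"
    using s c cz norm_triangle_ineq4[of 1 "c * z"]
    by (intro mult_mono powr_mono2) auto
  finally show "norm (deriv (\<lambda>z. (1 - c * z) powr of_real s) z) \<le> s * 2 powr (s - 1)" by simp
qed

text \<open>
Let \<open>A\<close> and \<open>A1\<close> be preimages of \<open>1\<close> and of the
identity. Then \<open>A1 / A\<close> is a left inverse of \<open>\<phi>\<close>. If \<open>\<phi>\<close> omitted a point, there would be a point \<open>b\<close>
of the disk on the boundary of its image, approached by \<open>\<phi> (x n)\<close> with \<open>x n\<close> tending to a point
\<open>w\<close> of the unit circle. The meromorphic function \<open>1 - cnj w * A1 / A\<close> then has nonzero order at \<open>b\<close>.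
The power with exponent \<open>1 + 1 / K\<close> of \<open>1 - cnj w * z\<close> belongs to the space, and its preimage
provides a \<open>K\<close>-th root of that meromorphic function near \<open>b\<close>, for every \<open>K\<close>. A \<open>K\<close> larger than the
order is impossible.
\<close>
lemma disk_automorphism_of_surj_weighted_comp_op:
  assumes p: "0 < p" and \<phi>: "\<phi> holomorphic_on \<bbbD>" "\<phi> ` \<bbbD> \<subseteq> \<bbbD>"
    and surj: "S_space p \<subseteq> weighted_comp_op \<psi> \<phi> ` S_space p"
  shows "disk_automorphism \<phi>"
proof -
  have lift: "\<exists>f. f holomorphic_on \<bbbD> \<and> (\<forall>z\<in>\<bbbD>. h z = \<psi> z * f (\<phi> z))"
    if h: "restrict h \<bbbD> \<in> S_space p" for h
  proof -
    obtain f where "f \<in> S_space p" "restrict h \<bbbD> = weighted_comp_op \<psi> \<phi> f"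
      using subsetD[OF surj h] by (rule imageE)
    hence "f holomorphic_on \<bbbD>" "\<forall>z\<in>\<bbbD>. h z = \<psi> z * f (\<phi> z)"
      by (auto simp: S_space_def weighted_comp_op_def fun_eq_iff split: if_splits)
    thus ?thesis by blast
  qed
  have "restrict (\<lambda>_. 1) \<bbbD> \<in> S_space p" "restrict (\<lambda>z. z) \<bbbD> \<in> S_space p"
    by (rule bounded_deriv_imp_S_space[OF p, where B = 1]; simp)+
  with lift obtain A A1 where hol: "A holomorphic_on \<bbbD>" "A1 holomorphic_on \<bbbD>"
    and A: "\<And>z. z \<in> \<bbbD> \<Longrightarrow> 1 = \<psi> z * A (\<phi> z)" and A1: "\<And>z. z \<in> \<bbbD> \<Longrightarrow> z = \<psi> z * A1 (\<phi> z)"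
    by metis
  have A_nz: "A (\<phi> z) \<noteq> 0" if "z \<in> \<bbbD>" for z
    using A[OF that] by auto
  \<comment> \<open>Dividing by the preimage of \<open>1\<close> eliminates \<open>\<psi>\<close>: every function of the space is
    a quotient composed with \<open>\<phi>\<close>.\<close>
  have quot: "h = k / A (\<phi> z)" if "z \<in> \<bbbD>" "h = \<psi> z * k" for h k z
  proof -
    have "\<psi> z = 1 / A (\<phi> z)"
      using A[OF that(1)] A_nz[OF that(1)] by (simp add: eq_divide_eq)
    thus ?thesis using that(2) by simp
  qed
  have inj: "inj_on \<phi> \<bbbD>"
  proof (rule inj_on_inverseI)
    show "A1 (\<phi> z) / A (\<phi> z) = z" if "z \<in> \<bbbD>" for z
      by (rule quot[OF that A1[OF that], symmetric])
  qed
  have "\<phi> ` \<bbbD> = \<bbbD>"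
  proof (rule ccontr)
    assume ne: "\<phi> ` \<bbbD> \<noteq> \<bbbD>"
    have op: "open (\<phi> ` \<bbbD>)"
      using open_mapping_thm3[OF \<phi>(1) _ inj] by simp
    \<comment> \<open>Otherwise the image would be open and closed in the connected disk.\<close>
    have "\<exists>b\<in>\<bbbD>. b \<in> closure (\<phi> ` \<bbbD>) \<and> b \<notin> \<phi> ` \<bbbD>"
    proof (rule ccontr)
      assume "\<not> ?thesis"
      hence "\<phi> ` \<bbbD> = \<bbbD> \<inter> closure (\<phi> ` \<bbbD>)"
        using \<phi>(2) closure_subset[of "\<phi> ` \<bbbD>"] by blast
      hence "closedin (top_of_set \<bbbD>) (\<phi> ` \<bbbD>)"
        by (metis closed_closure closedin_closed)
      moreover have "openin (top_of_set \<bbbD>) (\<phi> ` \<bbbD>)"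
        using op \<phi>(2) by (simp add: open_openin_trans)
      moreover have "\<phi> ` \<bbbD> \<noteq> {}" by simp
      ultimately show False
        using connected_clopen[of \<bbbD>] ne by auto
    qed
    then obtain b where b: "b \<in> \<bbbD>" "b \<in> closure (\<phi> ` \<bbbD>)" "b \<notin> \<phi> ` \<bbbD>" by blast
    then obtain u where u: "\<And>n. u n \<in> \<phi> ` \<bbbD>" "u \<longlonglongrightarrow> b"
      unfolding closure_sequential by blast
    have "\<exists>z. z \<in> \<bbbD> \<and> u n = \<phi> z" for n
      using u(1)[of n] by auto
    then obtain y where y: "\<And>n. y n \<in> \<bbbD>" "\<And>n. u n = \<phi> (y n)"
      by metis
    have "compact (cball 0 1 :: complex set)" "\<forall>n. y n \<in> cball 0 1"
      using y(1) by (auto simp: less_imp_le)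
    then obtain w r where w: "w \<in> cball 0 1" "strict_mono r" "(y \<circ> r) \<longlonglongrightarrow> w"
      unfolding compact_def by blast
    define x where "x = y \<circ> r"
    have x: "\<And>n. x n \<in> \<bbbD>" "x \<longlonglongrightarrow> w" "(\<lambda>n. \<phi> (x n)) \<longlonglongrightarrow> b"
      using y w(3) LIMSEQ_subseq_LIMSEQ[OF u(2) w(2)] by (auto simp: x_def o_def)
    \<comment> \<open>If \<open>w\<close> were in the disk, continuity would give \<open>\<phi> w = b\<close>, but \<open>b\<close> is not in the image.\<close>
    have w1: "norm w = 1"
    proof (rule ccontr)
      assume "norm w \<noteq> 1"
      hence wD: "w \<in> \<bbbD>" using w(1) by simp
      hence "isCont \<phi> w"
        using holomorphic_on_imp_continuous_on[OF \<phi>(1)] by (simp add: continuous_on_eq_continuous_at)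
      hence "(\<lambda>n. \<phi> (x n)) \<longlonglongrightarrow> \<phi> w"
        using x(2) by (rule isCont_tendsto_compose)
      thus False using x(3) b(3) wD LIMSEQ_unique by blast
    qed
    \<comment> \<open>Since \<open>\<bar>w\<bar> = 1\<close>, the factor \<open>1 - cnj w * z\<close> vanishes at \<open>z = w\<close> and nowhere in the disk.\<close>
    define B where "B = (\<lambda>v. A v - cnj w * A1 v)"
    have holB: "B holomorphic_on \<bbbD>"
      unfolding B_def by (intro holomorphic_intros hol)
    have B: "B (\<phi> z) = (1 - cnj w * z) * A (\<phi> z)" if "z \<in> \<bbbD>" for z
    proof -
      have "A1 (\<phi> z) = z * A (\<phi> z)"
        using quot[OF that A1[OF that]] A_nz[OF that] by (simp add: eq_divide_eq)
      thus ?thesis by (simp add: B_def algebra_simps)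
    qed
    have nz: "\<exists>v\<in>\<bbbD>. A v \<noteq> 0" "\<exists>v\<in>\<bbbD>. B v \<noteq> 0"
    proof -
      have "\<phi> 0 \<in> \<phi> ` \<bbbD>" by (rule imageI) simp
      hence "\<phi> 0 \<in> \<bbbD>" using \<phi>(2) by blast
      moreover have "A (\<phi> 0) \<noteq> 0" "B (\<phi> 0) \<noteq> 0"
        using A_nz[of 0] B[of 0] by simp_all
      ultimately show "\<exists>v\<in>\<bbbD>. A v \<noteq> 0" "\<exists>v\<in>\<bbbD>. B v \<noteq> 0" by blast+
    qed
    have neq: "zorder A b \<noteq> zorder B b"
    proof (rule zorder_neq_of_quotient_tendsto_0[OF hol(1) holB _ _ b(1) nz x(3)])
      show "\<phi> (x n) \<noteq> b" for n
        using x(1)[of n] b(3) by blast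
      have "(\<lambda>n. 1 - cnj w * x n) \<longlonglongrightarrow> 1 - cnj w * w"
        by (intro tendsto_intros x)
      moreover have "cnj w * w = 1"
        using w1 complex_norm_square[of w] by (simp add: mult.commute)
      moreover have "B (\<phi> (x n)) / A (\<phi> (x n)) = 1 - cnj w * x n" for n
        using B[OF x(1)] A_nz[OF x(1)] by simp
      ultimately show "(\<lambda>n. B (\<phi> (x n)) / A (\<phi> (x n))) \<longlonglongrightarrow> 0" by simp
    qed auto
    \<comment> \<open>Adding \<open>1\<close> makes \<open>K\<close> positive and larger than the nonzero order of \<open>B / A\<close>, so it
      cannot divide it.\<close>
    define K where "K = nat \<bar>zorder B b - zorder A b\<bar> + 1"
    have K_pos: "0 < K" by (simp add: K_def)
    define s where "s = 1 + 1 / real K"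
    have "restrict (\<lambda>z. (1 - cnj w * z) powr of_real s) \<bbbD> \<in> S_space p"
      using w1 by (intro boundary_root_in_S_space p) (auto simp: s_def)
    from lift[OF this] obtain C where holC: "C holomorphic_on \<bbbD>"
      and C: "\<And>z. z \<in> \<bbbD> \<Longrightarrow> (1 - cnj w * z) powr of_real s = \<psi> z * C (\<phi> z)"
      by blast
    have "C v ^ K * A v = B v ^ (K + 1)" if "v \<in> \<bbbD>" for v
    proof (rule analytic_continuation_open[OF op open_ball _ _ \<phi>(2) _ _ _ that])
      fix v assume "v \<in> \<phi> ` \<bbbD>"
      then obtain z where z: "z \<in> \<bbbD>" "v = \<phi> z" by blast
      have "norm (cnj w * z) < 1"
        using z(1) w1 by (simp add: norm_mult)
      hence ne1: "1 - cnj w * z \<noteq> 0" by auto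
      have "((1 - cnj w * z) powr of_real s) ^ K = (1 - cnj w * z) powr (of_nat K * of_real s)"
        using ne1 by (simp add: powr_def exp_of_nat_mult[symmetric] mult.assoc)
      also have "of_nat K * complex_of_real s = of_nat (K + 1)"
        using K_pos by (simp add: s_def field_simps)
      also have "(1 - cnj w * z) powr of_nat (K + 1) = (1 - cnj w * z) ^ (K + 1)"
        using ne1 by (rule powr_complexpow)
      finally have root: "((1 - cnj w * z) powr of_real s) ^ K = (1 - cnj w * z) ^ (K + 1)" .
      have "C v = (1 - cnj w * z) powr of_real s * A v"
        using quot[OF z(1) C[OF z(1)]] A_nz[OF z(1)] z(2) by (simp add: eq_divide_eq)
      hence "C v ^ K * A v = ((1 - cnj w * z) powr of_real s) ^ K * A v ^ (K + 1)"
        by (simp add: power_mult_distrib)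
      also have "\<dots> = B v ^ (K + 1)"
        unfolding root using B[OF z(1)] z(2) by (simp add: power_mult_distrib)
      finally show "C v ^ K * A v = B v ^ (K + 1)" .
    qed (auto intro!: holomorphic_intros holC holB hol)
    from dvd_zorder_diff[OF hol(1) holB holC _ _ b(1) nz K_pos this]
    have "int K dvd zorder B b - zorder A b" by simp
    hence "\<bar>zorder B b - zorder A b\<bar> \<ge> int K"
      using neq by (intro zdvd_imp_le) auto
    thus False by (simp add: K_def)
  qed
  with inj \<phi>(1) show ?thesis
    by (simp add: disk_automorphism_def bij_betw_def)
qed

theorem theorem3p1:
  fixes p :: real and \<psi> \<phi> :: "complex \<Rightarrow> complex"
  assumes "0 < p"
    and "\<psi> holomorphic_on \<bbbD>"
    and "\<phi> holomorphic_on \<bbbD>"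
    and "\<phi> ` \<bbbD> \<subseteq> \<bbbD>"
  shows "(invertible_on_S p (comp_op \<phi>) \<longleftrightarrow> disk_automorphism \<phi>) \<and>
    (invertible_on_S p (weighted_comp_op \<psi> \<phi>) \<longleftrightarrow>
       disk_automorphism \<phi> \<and> S_multiplier p \<psi> \<and> reciprocal_S_multiplier p \<psi>)"
proof (intro conjI iffI)
  have auto: "disk_automorphism \<phi>" if "invertible_on_S p (weighted_comp_op \<omega> \<phi>)" for \<omega>
    using that assms(1,3,4)
    by (intro disk_automorphism_of_surj_weighted_comp_op) (auto simp: invertible_on_S_def bij_betw_def)
  show "disk_automorphism \<phi>" if "invertible_on_S p (comp_op \<phi>)"
  proof (rule auto)
    have "weighted_comp_op (\<lambda>_. 1) \<phi> = comp_op \<phi>"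
      by (simp add: weighted_comp_op_def comp_op_def fun_eq_iff)
    thus "invertible_on_S p (weighted_comp_op (\<lambda>_. 1) \<phi>)" using that by simp
  qed
  show "invertible_on_S p (comp_op \<phi>)" if "disk_automorphism \<phi>"
    using assms(1) that by (rule comp_op_invertible)
  show "disk_automorphism \<phi>" "S_multiplier p \<psi>" "reciprocal_S_multiplier p \<psi>"
    if "invertible_on_S p (weighted_comp_op \<psi> \<phi>)"
    using auto[OF that] multipliers_of_invertible_weighted_comp_op[OF assms(1) auto[OF that] that]
    by blast+
  show "invertible_on_S p (weighted_comp_op \<psi> \<phi>)"
    if "disk_automorphism \<phi> \<and> S_multiplier p \<psi> \<and> reciprocal_S_multiplier p \<psi>"
    unfolding weighted_comp_op_eq[OF assms(4)]
    using that assms(1) by (intro invertible_on_S_comp multiplication_invertible comp_op_invertible) auto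
qed

end
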